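(* Let $f:\mathbb{R}^N\to\mathbb{R}^N$ be $C^1$ with equilibrium $x_\ast$, and fix $T>0$. Suppose there exist $\lambda_\ast>0$ and $n\in\mathbb{Z}$ with $\lambda_\ast\pm\frac{2\pi n i}{T}\in\sigma(f'(x_\ast))$. Let $K\in\mathbb{R}^{N\times N}$ (with arbitrary spectrum) satisfy $f'(x_\ast)K=Kf'(x_\ast)$. Then $\det(\lambda I-f'(x_\ast)-K[1-e^{-\lambda T}])=0$ has a root with $\mathrm{Re}\,\lambda>0$; in particular $x_\ast$ is unstable as a solution of $\dot x(t)=f(x(t))+K[x(t)-x(t-T)]$.
   Context: Eigenvalues of the linearized delay equation $\dot y(t)=f'(x_\ast)y(t)+K[y(t)-y(t-T)]$ are the roots of $\lambda\mapsto\det(\lambda I-f'(x_\ast)-K[1-e^{-\lambda T}])$. *)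

theory Defs
  imports "HOL-Analysis.Analysis"
begin

text \<open>Complexification of a real square matrix.\<close>
definition cmat :: "real^'n^'n \<Rightarrow> complex^'n^'n" where
  "cmat A = (\<chi> i j. complex_of_real (A $ i $ j))"

text \<open>Spectrum of a real square matrix: its complex eigenvalues.\<close>
definition mat_spectrum :: "real^'n^'n \<Rightarrow> complex set" where
  "mat_spectrum A = {\<mu>. \<exists>v::complex^'n. v \<noteq> 0 \<and> cmat A *v v = \<mu> *s v}"

text \<open>Characteristic function of the linearized delay equation
  y'(t) = A y(t) + K [y(t) - y(t - T)].\<close>
definition char_fun :: "real^'n^'n \<Rightarrow> real^'n^'n \<Rightarrow> real \<Rightarrow> complex \<Rightarrow> complex" where
  "char_fun A K T z =
     det (mat z - cmat A - mat (1 - exp (- z * complex_of_real T)) ** cmat K)"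

end

theory Submission
  imports Defs "HOL-Computational_Algebra.Fundamental_Theorem_Algebra"
begin

(* Since A = f'(xs) and K commute, the eigenspace of A for a = lam + 2 pi n i / T is K-invariant,
   so A and K share an eigenvector w with A w = a w and K w = k w.  On w the characteristic matrix
   acts as the scalar z - a - (1 - e^(-zT)) k, so it suffices to find a root of this scalar
   function with Re z > 0.  Writing z = a + (s - b)/T with b = -kT turns the scalar equation into
   s e^s = e^(-lam T) b e^b, and Re z > 0 follows from |s| < |b|.

   Such a "shrunken" solution of the Lambert-type equation is found in polar coordinates
   s = R e^(i phi), b = r e^(i theta): one has to solve ln R + R cos phi = t together with
   phi + R sin phi = theta + r sin theta (mod 2 pi).  Moving along the level curve
   phi + R sin phi = C, the first quantity passes from its value at R = r down below t, so the
   intermediate value theorem gives a solution; strict concavity of sin on [0, pi] keeps R < r. *)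

lemma sin_strict_concave:
  fixes x y z :: real
  assumes "0 \<le> x" "x < y" "y < z" "z \<le> pi"
  shows "(z - y) * sin x + (y - x) * sin z < (z - x) * sin y"
proof -
  obtain p where p: "x < p" "p < y" "sin y - sin x = (y - x) * cos p"
    using MVT2[of x y sin cos] assms(2) by (auto intro!: derivative_eq_intros)
  obtain q where q: "y < q" "q < z" "sin z - sin y = (z - y) * cos q"
    using MVT2[of y z sin cos] assms(3) by (auto intro!: derivative_eq_intros)
  have "cos q < cos p" using cos_monotone_0_pi[of p q] p q assms by linarith
  hence "(z - y) * (y - x) * cos q < (z - y) * (y - x) * cos p"
    using assms by (intro mult_strict_left_mono) auto
  moreover have "(y - x) * (sin z - sin y) = (z - y) * (y - x) * cos q" using q(3) by simp
  moreover have "(z - y) * (sin y - sin x) = (z - y) * (y - x) * cos p" using p(3) by simp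
  ultimately have "(y - x) * (sin z - sin y) < (z - y) * (sin y - sin x)" by linarith
  thus ?thesis by (simp add: algebra_simps)
qed

lemma sin_less_self:
  fixes x :: real
  assumes "0 < x" "x \<le> pi"
  shows "sin x < x"
proof -
  obtain p where p: "0 < p" "p < x" "sin x - sin 0 = (x - 0) * cos p"
    using MVT2[of 0 x sin cos] assms by (auto intro!: derivative_eq_intros)
  have "cos p < cos 0" using p assms by (intro cos_monotone_0_pi) auto
  hence "x * cos p < x * 1" using assms by (intro mult_strict_left_mono) auto
  thus ?thesis using p by simp
qed

lemma one_minus_cos_le_sin:
  fixes u :: real
  assumes "0 \<le> u" "u \<le> pi / 2"
  shows "1 - cos u \<le> sin u"
proof (rule ccontr)
  assume "\<not> ?thesis"
  hence lt: "sin u < 1 - cos u" by simp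
  have c: "cos u \<ge> 0" using assms by (intro cos_ge_zero) auto
  have s: "sin u \<ge> 0" using assms by (intro sin_ge_zero) auto
  have "sin u * sin u < (1 - cos u) * (1 - cos u)" using lt s by (intro mult_strict_mono) auto
  moreover have "sin u * sin u = (1 - cos u) * (1 + cos u)"
    using sin_squared_eq[of u] by (simp add: power2_eq_square algebra_simps)
  ultimately have "(1 - cos u) * (1 + cos u) < (1 - cos u) * (1 - cos u)" by simp
  moreover have "1 - cos u > 0" using lt s by linarith
  ultimately have "1 + cos u < 1 - cos u" by (simp add: mult_less_cancel_left)
  thus False using c by simp
qed

lemma ln_add_mult_ivt:
  fixes r c t :: real
  assumes "r > 0" "t < ln r + r * c" "c \<le> 1"
  shows "\<exists>R. 0 < R \<and> R < r \<and> ln R + R * c = t"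
proof -
  define R0 where "R0 = min (r/2) (exp (t - r))"
  have R0: "0 < R0" "R0 < r" "R0 \<le> exp (t - r)" using assms unfolding R0_def by auto
  have "ln R0 \<le> t - r" using R0 by (metis ln_exp ln_le_cancel_iff exp_gt_zero)
  moreover have "R0 * c \<le> R0" using R0 assms by (simp add: mult_left_le)
  ultimately have lo: "ln R0 + R0 * c < t" using R0 by linarith
  have "continuous_on {R0..r} (\<lambda>R. ln R + R * c)"
    using R0 by (intro continuous_intros) auto
  then obtain R where "R0 \<le> R" "R \<le> r" "ln R + R * c = t"
    using IVT'[of "\<lambda>R. ln R + R * c" R0 t r] lo assms R0 by auto
  moreover have "R \<noteq> r" using assms \<open>ln R + R * c = t\<close> by auto
  ultimately show ?thesis using R0 by (intro exI[of _ R]) auto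
qed

lemma add_mult_sin_gt_between:
  fixes r x y z C :: real
  assumes "r > 0" "0 \<le> x" "x < y" "y < z" "z \<le> pi"
    and "x + r * sin x = C" "z + r * sin z \<ge> C"
  shows "y + r * sin y > C"
proof -
  have s: "(z - y) * sin x + (y - x) * sin z < (z - x) * sin y"
    by (rule sin_strict_concave) (use assms in auto)
  have "(z - x) * C = (z - y) * C + (y - x) * C" by (simp add: algebra_simps)
  also have "\<dots> \<le> (z - y) * (x + r * sin x) + (y - x) * (z + r * sin z)"
    using assms by (intro add_mono mult_left_mono) auto
  also have "\<dots> = (z - x) * y + r * ((z - y) * sin x + (y - x) * sin z)"
    by (simp add: algebra_simps)
  also have "\<dots> < (z - x) * y + r * ((z - x) * sin y)"
    using s assms(1) by simp
  also have "\<dots> = (z - x) * (y + r * sin y)" by (simp add: algebra_simps)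
  finally show ?thesis using assms by (simp add: mult_less_cancel_left)
qed

lemma add_mult_sin_eq_below:
  fixes r \<theta> C :: real
  assumes "r > 0" "0 \<le> \<theta>" "\<theta> \<le> pi" "0 < C" "C \<le> \<theta> + r * sin \<theta>" "C < pi \<or> \<theta> < pi"
  shows "\<exists>a. 0 < a \<and> a < C \<and> a \<le> \<theta> \<and> a + r * sin a = C"
proof -
  have "continuous_on {0..\<theta>} (\<lambda>x. x + r * sin x)" by (intro continuous_intros)
  then obtain a where a: "0 \<le> a" "a \<le> \<theta>" "a + r * sin a = C"
    using IVT'[of "\<lambda>x. x + r * sin x" 0 C \<theta>] assms by auto
  have "a \<noteq> 0" using assms a by auto
  moreover have "a \<noteq> pi" using assms a by auto
  ultimately have "sin a > 0" using a assms by (intro sin_gt_zero) auto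
  hence "a < C" using a assms by (smt (verit) mult_pos_pos)
  thus ?thesis using a \<open>a \<noteq> 0\<close> by (intro exI[of _ a]) auto
qed

lemma level_curve_ivt:
  fixes r a b C t :: real
  assumes "r > 0" "0 < a" "a < b" "b < C" "C \<le> pi" "a + r * sin a = C"
    and "t < ln r + r * cos a"
    and "ln ((C - b) / sin b) + (C - b) / sin b * cos b \<le> t"
  shows "\<exists>\<phi> R. 0 < R \<and> R < r \<and> ln R + R * cos \<phi> = t \<and> \<phi> + R * sin \<phi> = C"
proof -
  \<comment> \<open>On the level curve, R = (C - \<phi>) / sin \<phi>.\<close>
  define H where "H = (\<lambda>\<phi>. ln ((C - \<phi>) / sin \<phi>) + (C - \<phi>) / sin \<phi> * cos \<phi>)"
  have sin_pos: "sin x > 0" if "a \<le> x" "x \<le> b" for x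
    using that assms by (intro sin_gt_zero) auto
  have "\<forall>x\<in>{a..b}. sin x \<noteq> 0 \<and> (C - x) / sin x > 0"
    using sin_pos assms by (auto intro!: divide_pos_pos simp: less_imp_neq[symmetric])
  hence "continuous_on {a..b} H"
    unfolding H_def by (intro continuous_intros) auto
  have Ha: "H a = ln r + r * cos a"
  proof -
    have "(C - a) / sin a = r" using assms(6) sin_pos[of a] assms by (simp add: field_simps)
    thus ?thesis unfolding H_def by simp
  qed
  obtain \<phi> where \<phi>: "a \<le> \<phi>" "\<phi> \<le> b" "H \<phi> = t"
    using IVT2'[of H b t a] \<open>continuous_on {a..b} H\<close> assms Ha unfolding H_def by force
  have "\<phi> \<noteq> a" using \<phi> Ha assms by auto
  hence "a < \<phi>" using \<phi> by auto
  have "sin C \<ge> 0" using assms by (intro sin_ge_zero) auto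
  hence "\<phi> + r * sin \<phi> > C"
    by (intro add_mult_sin_gt_between[of r a \<phi> C C]) (use assms \<phi> \<open>a < \<phi>\<close> in auto)
  moreover have sp: "sin \<phi> > 0" using sin_pos \<phi> by auto
  ultimately have "(C - \<phi>) / sin \<phi> < r" by (simp add: field_simps)
  moreover have "(C - \<phi>) / sin \<phi> > 0" using sp \<phi> assms by auto
  moreover have "\<phi> + (C - \<phi>) / sin \<phi> * sin \<phi> = C" using sp by simp
  ultimately show ?thesis using \<phi> unfolding H_def
    by (intro exI[of _ \<phi>] exI[of _ "(C - \<phi>) / sin \<phi>"]) auto
qed

lemma level_curve_end_below:
  fixes a C t :: real
  assumes "a < C" "0 < C" "C < pi"
  shows "\<exists>b. a < b \<and> b < C \<and> ln ((C - b) / sin b) + (C - b) / sin b * cos b \<le> t"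
proof -
  define \<epsilon> where "\<epsilon> = min 1 (exp (t - 1))"
  have \<epsilon>: "0 < \<epsilon>" "\<epsilon> \<le> 1" "\<epsilon> \<le> exp (t - 1)"
    unfolding \<epsilon>_def by auto
  hence "ln \<epsilon> \<le> t - 1" by (metis ln_exp ln_le_cancel_iff exp_gt_zero)
  have "((\<lambda>b. (C - b) / sin b) \<longlongrightarrow> (C - C) / sin C) (at_left C)"
    using assms sin_gt_zero[of C] by (intro tendsto_intros) auto
  hence "eventually (\<lambda>b. (C - b) / sin b < \<epsilon>) (at_left C)"
    using \<epsilon> by (intro order_tendstoD) auto
  moreover have "eventually (\<lambda>b. b \<in> {max a 0<..<C}) (at_left C)"
    using assms by (intro eventually_at_left_real) auto
  ultimately obtain b where b: "(C - b) / sin b < \<epsilon>" "max a 0 < b" "b < C"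
    using eventually_happens[OF eventually_conj] by (fastforce simp: trivial_limit_at_left_real)
  define R where "R = (C - b) / sin b"
  have "sin b > 0" using b assms by (intro sin_gt_zero) auto
  hence R: "0 < R" "R < \<epsilon>" using b unfolding R_def by auto
  have "ln R \<le> ln \<epsilon>" using R by simp
  moreover have "R * cos b \<le> R" using R by (simp add: mult_left_le)
  ultimately have "ln R + R * cos b \<le> t" using \<open>ln \<epsilon> \<le> t - 1\<close> \<epsilon> R by linarith
  thus ?thesis using b unfolding R_def by auto
qed

lemma level_curve_root:
  fixes r \<theta> C t :: real
  assumes "r > 0" "0 \<le> \<theta>" "\<theta> \<le> pi" "0 < C" "C < pi" "C \<le> \<theta> + r * sin \<theta>"
    and "t < ln r + r * cos \<theta>"
  shows "\<exists>\<phi> R. 0 < R \<and> R < r \<and> ln R + R * cos \<phi> = t \<and> \<phi> + R * sin \<phi> = C"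
proof -
  obtain a where a: "0 < a" "a < C" "a \<le> \<theta>" "a + r * sin a = C"
    using add_mult_sin_eq_below assms by blast
  have "cos \<theta> \<le> cos a" using a assms by (intro cos_monotone_0_pi_le) auto
  hence "t < ln r + r * cos a" using assms by (smt (verit) mult_left_mono)
  moreover obtain b where "a < b" "b < C" "ln ((C - b) / sin b) + (C - b) / sin b * cos b \<le> t"
    using level_curve_end_below[of a C t] a assms by blast
  ultimately show ?thesis using a assms by (intro level_curve_ivt[of r a b C t]) auto
qed

lemma level_curve_root_pi:
  fixes r \<theta> t :: real
  assumes "r > 0" "0 \<le> \<theta>" "\<theta> < pi" "pi \<le> \<theta> + r * sin \<theta>"
    and "t < ln r + r * cos \<theta>" "-1 < t"
  shows "\<exists>\<phi> R. 0 < R \<and> R < r \<and> ln R + R * cos \<phi> = t \<and> \<phi> + R * sin \<phi> = pi"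
proof -
  obtain a where a: "0 < a" "a < pi" "a \<le> \<theta>" "a + r * sin a = pi"
    using add_mult_sin_eq_below[of r \<theta> pi] assms by auto
  have "cos \<theta> \<le> cos a" using a assms by (intro cos_monotone_0_pi_le) auto
  hence ta: "t < ln r + r * cos a" using assms by (smt (verit) mult_left_mono)
  \<comment> \<open>Near the end of the level curve R tends to 1, not to 0; this is why t > -1 is needed.\<close>
  define u where "u = min ((t + 1) / 2) ((pi - a) / 2)"
  have u: "0 < u" "u < t + 1" "u \<le> pi / 2" "u < pi - a"
    unfolding u_def using a assms by (auto simp: min_def)
  have su: "sin u > 0" using u by (intro sin_gt_zero) auto
  define R where "R = u / sin u"
  have R: "R > 0" unfolding R_def using u su by auto
  have "ln R \<le> R - 1" using R by (rule ln_le_minus_one)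
  moreover have "R * (1 - cos u) \<le> R * sin u"
    using one_minus_cos_le_sin[of u] u R by (intro mult_left_mono) auto
  moreover have "R * sin u = u" unfolding R_def using su by simp
  ultimately have "ln R + R * (- cos u) \<le> t" using u by (simp add: algebra_simps)
  hence "ln ((pi - (pi - u)) / sin (pi - u)) + (pi - (pi - u)) / sin (pi - u) * cos (pi - u) \<le> t"
    unfolding R_def by simp
  thus ?thesis using a u ta assms by (intro level_curve_ivt[of r a "pi - u" pi t]) auto
qed

lemma level_curve_root_half_turn:
  fixes r \<theta> t :: real
  assumes "r > 0" "0 \<le> \<theta>" "\<theta> < pi" "pi \<le> \<theta> + r * sin \<theta>" "t < ln r + r * cos \<theta>"
  shows "\<exists>\<phi> R. 0 < R \<and> R < r \<and> ln R + R * cos \<phi> = t \<and> \<phi> + R * sin \<phi> = pi"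
proof -
  have "r > 1"
  proof (rule ccontr)
    assume "\<not> r > 1"
    hence "r * sin \<theta> \<le> 1 * sin \<theta>" using assms by (intro mult_right_mono sin_ge_zero) auto
    moreover have "\<theta> \<noteq> 0"
    proof
      assume "\<theta> = 0"
      hence "pi \<le> 0" using assms(4) by simp
      thus False using pi_gt_zero by linarith
    qed
    hence "sin (pi - \<theta>) < pi - \<theta>" using assms by (intro sin_less_self) auto
    ultimately show False using assms by simp
  qed
  consider "-1 < t" | "t = -1" | "t < -1" by fastforce
  thus ?thesis
  proof cases
    case 1 thus ?thesis using level_curve_root_pi assms by blast
  next
    case 2 thus ?thesis using \<open>r > 1\<close> by (intro exI[of _ pi] exI[of _ 1]) auto
  next
    case 3
    then obtain R where "0 < R" "R < 1" "ln R + R * (-1) = t"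
      using ln_add_mult_ivt[of 1 t "-1"] by auto
    thus ?thesis using \<open>r > 1\<close> by (intro exI[of _ pi] exI[of _ R]) auto
  qed
qed

lemma reduced_angle_exists:
  fixes Y :: real
  assumes "0 \<le> Y" "cis Y \<noteq> 1" "cis Y \<noteq> -1"
  obtains C where "0 < C" "C < pi" "C \<le> Y" "cis C = cis Y \<or> cis (- C) = cis Y"
proof -
  define A where "A = Arg (cis Y)"
  have "cis A = cis Y" unfolding A_def using rcis_cmod_Arg[of "cis Y"] by (simp add: cis_rcis_eq)
  moreover have "- pi < A" "A \<le> pi" unfolding A_def using Arg_bounded by auto
  moreover have "A \<noteq> 0" "A \<noteq> pi" using \<open>cis A = cis Y\<close> assms by auto
  ultimately have "0 < \<bar>A\<bar>" "\<bar>A\<bar> < pi" by auto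
  moreover have "\<bar>A\<bar> \<le> Y"
  proof (cases "Y < pi")
    case True
    hence "A = Y" unfolding A_def using assms by (intro Arg_cis) auto
    thus ?thesis using assms by simp
  qed (use \<open>\<bar>A\<bar> < pi\<close> in auto)
  moreover have "cis \<bar>A\<bar> = cis Y \<or> cis (- \<bar>A\<bar>) = cis Y"
    using \<open>cis A = cis Y\<close> by (auto simp: abs_if)
  ultimately show ?thesis by (intro that) auto
qed

lemma polar_root:
  fixes r \<theta> t :: real
  assumes r: "r > 0" and \<theta>: "0 \<le> \<theta>" "\<theta> \<le> pi" and t: "t < ln r + r * cos \<theta>"
  shows "\<exists>R \<phi>. 0 < R \<and> R < r \<and> ln R + R * cos \<phi> = t
            \<and> cis (\<phi> + R * sin \<phi>) = cis (\<theta> + r * sin \<theta>)"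
proof -
  define Y where "Y = \<theta> + r * sin \<theta>"
  have "r * cos \<theta> \<le> r * 1" using r by (intro mult_left_mono) auto
  have "sin \<theta> \<ge> 0" using \<theta> by (intro sin_ge_zero)
  hence "Y \<ge> 0" unfolding Y_def using \<theta> r by simp
  consider "cis Y = 1" | "\<theta> = pi" | "\<theta> < pi" "cis Y = -1" | "\<theta> < pi" "cis Y \<noteq> 1" "cis Y \<noteq> -1"
    using \<theta> by fastforce
  thus ?thesis
  proof cases
    case 1
    obtain R where "0 < R" "R < r" "ln R + R * 1 = t"
      using ln_add_mult_ivt[of r t 1] r t \<open>r * cos \<theta> \<le> r * 1\<close> by auto
    thus ?thesis using 1 unfolding Y_def by (intro exI[of _ R] exI[of _ 0]) auto
  next
    case 2
    obtain R where "0 < R" "R < r" "ln R + R * (-1) = t"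
      using ln_add_mult_ivt[of r t "-1"] r t 2 by auto
    thus ?thesis using 2 by (intro exI[of _ R] exI[of _ pi]) auto
  next
    case 3
    have "pi \<le> Y"
    proof (rule ccontr)
      assume "\<not> pi \<le> Y"
      hence "cos pi < cos Y" using \<open>Y \<ge> 0\<close> by (intro cos_monotone_0_pi) auto
      moreover have "cos Y = -1" using arg_cong[OF 3(2), of Re] by simp
      ultimately show False by simp
    qed
    then obtain \<phi> R where "0 < R" "R < r" "ln R + R * cos \<phi> = t" "\<phi> + R * sin \<phi> = pi"
      using level_curve_root_half_turn[of r \<theta> t] r \<theta> t 3 unfolding Y_def by blast
    thus ?thesis using 3 unfolding Y_def by (intro exI[of _ R] exI[of _ \<phi>]) auto
  next
    case 4
    obtain C where C: "0 < C" "C < pi" "C \<le> Y" "cis C = cis Y \<or> cis (- C) = cis Y"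
      using reduced_angle_exists 4 \<open>Y \<ge> 0\<close> by blast
    then obtain \<phi> R where sol: "0 < R" "R < r" "ln R + R * cos \<phi> = t" "\<phi> + R * sin \<phi> = C"
      using level_curve_root[of r \<theta> C t] r \<theta> t unfolding Y_def by blast
    from C(4) show ?thesis
    proof
      assume "cis C = cis Y"
      thus ?thesis using sol unfolding Y_def by (intro exI[of _ R] exI[of _ \<phi>]) auto
    next
      assume "cis (- C) = cis Y"
      moreover have "- \<phi> + R * sin (- \<phi>) = - C" using sol by simp
      ultimately show ?thesis
        using sol unfolding Y_def by (intro exI[of _ R] exI[of _ "- \<phi>"]) auto
    qed
  qed
qed

lemma rcis_mult_exp_rcis:
  "rcis R \<phi> * exp (rcis R \<phi>) = complex_of_real (R * exp (R * cos \<phi>)) * cis (\<phi> + R * sin \<phi>)"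
proof -
  have "exp (rcis R \<phi>) = complex_of_real (exp (R * cos \<phi>)) * cis (R * sin \<phi>)"
    by (simp add: exp_eq_polar)
  thus ?thesis by (simp add: rcis_def cis_mult[symmetric] algebra_simps)
qed

lemma lambert_root_shrink_upper:
  fixes b :: complex and \<rho> :: real
  assumes "b \<noteq> 0" "Im b \<ge> 0" "0 < \<rho>" "\<rho> < 1"
  shows "\<exists>s. cmod s < cmod b \<and> s * exp s = complex_of_real \<rho> * b * exp b"
proof -
  define r where "r = cmod b"
  define \<theta> where "\<theta> = Arg b"
  have r: "r > 0" unfolding r_def using assms by auto
  have \<theta>: "0 \<le> \<theta>" "\<theta> \<le> pi" unfolding \<theta>_def using assms Arg_less_0 Arg_le_pi by auto
  have b: "b = rcis r \<theta>" unfolding r_def \<theta>_def by (simp add: rcis_cmod_Arg)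
  have "ln \<rho> + ln r + r * cos \<theta> < ln r + r * cos \<theta>" using assms by simp
  then obtain R \<phi> where R: "0 < R" "R < r" "ln R + R * cos \<phi> = ln \<rho> + ln r + r * cos \<theta>"
      "cis (\<phi> + R * sin \<phi>) = cis (\<theta> + r * sin \<theta>)"
    using polar_root[OF r \<theta>] by blast
  have "R * exp (R * cos \<phi>) = exp (ln R + R * cos \<phi>)" using R(1) by (simp add: exp_add)
  also have "\<dots> = \<rho> * (r * exp (r * cos \<theta>))" unfolding R(3) using r assms by (simp add: exp_add)
  finally have "rcis R \<phi> * exp (rcis R \<phi>) = complex_of_real \<rho> * (b * exp b)"
    unfolding b rcis_mult_exp_rcis R(4) by simp
  moreover have "cmod (rcis R \<phi>) < cmod b" using R unfolding r_def by simp
  ultimately show ?thesis by (intro exI[of _ "rcis R \<phi>"]) (simp add: mult.assoc)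
qed

lemma lambert_root_shrink:
  fixes b :: complex and \<rho> :: real
  assumes "b \<noteq> 0" "0 < \<rho>" "\<rho> < 1"
  shows "\<exists>s. cmod s < cmod b \<and> s * exp s = complex_of_real \<rho> * b * exp b"
proof (cases "Im b \<ge> 0")
  case True thus ?thesis using lambert_root_shrink_upper assms by blast
next
  case False
  obtain s where s: "cmod s < cmod (cnj b)" "s * exp s = complex_of_real \<rho> * cnj b * exp (cnj b)"
    using lambert_root_shrink_upper[of "cnj b" \<rho>] assms False by auto
  have "cnj s * exp (cnj s) = cnj (s * exp s)" by (simp add: exp_cnj)
  also have "\<dots> = complex_of_real \<rho> * b * exp b" unfolding s(2) by (simp add: exp_cnj[symmetric])
  finally show ?thesis using s(1) by (intro exI[of _ "cnj s"]) auto
qed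

lemma lambert_root_Re_gt:
  fixes b :: complex and \<rho> :: real
  assumes "b \<noteq> 0" "0 < \<rho>" "\<rho> < 1"
  shows "\<exists>s. Re b + ln \<rho> < Re s \<and> s * exp s = complex_of_real \<rho> * b * exp b"
proof -
  obtain s where s: "cmod s < cmod b" "s * exp s = complex_of_real \<rho> * b * exp b"
    using lambert_root_shrink[OF assms] by blast
  have "s \<noteq> 0" using s(2) assms by auto
  have "cmod s * exp (Re s) = \<rho> * cmod b * exp (Re b)"
    using arg_cong[OF s(2), of cmod] assms by (simp add: norm_mult)
  also have "\<dots> > cmod s * (\<rho> * exp (Re b))"
    using s(1) assms by (simp add: mult.assoc mult_strict_right_mono mult.left_commute)
  finally have "exp (Re s) > \<rho> * exp (Re b)"
    using \<open>s \<noteq> 0\<close> by (simp add: mult_less_cancel_left)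
  hence "exp (Re s) > exp (Re b + ln \<rho>)" using assms by (simp add: exp_add mult.commute)
  thus ?thesis using s(2) by auto
qed

lemma exp_minus_mult_2pi_shift:
  fixes T lam :: real and n :: int
  assumes "T > 0"
  shows "exp (- (complex_of_real lam + 2 * of_real pi * of_int n * \<i> / complex_of_real T)
                * complex_of_real T) = exp (complex_of_real (- lam * T))"
proof -
  have "- (complex_of_real lam + 2 * of_real pi * of_int n * \<i> / complex_of_real T) * complex_of_real T
          = complex_of_real (- lam * T) - complex_of_real (2 * real_of_int n * pi) * \<i>"
    using assms by (simp add: field_simps)
  moreover have "exp (complex_of_real (2 * real_of_int n * pi) * \<i>) = 1"
    by (rule exp_integer_2pi) simp
  ultimately show ?thesis by (simp add: exp_diff)
qed

lemma scalar_char_root: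
  fixes T lam :: real and n :: int and k :: complex
  assumes T: "T > 0" and lam: "lam > 0"
  defines "a \<equiv> complex_of_real lam + 2 * of_real pi * of_int n * \<i> / complex_of_real T"
  shows "\<exists>z. Re z > 0 \<and> z - a - (1 - exp (- z * complex_of_real T)) * k = 0"
proof (cases "k = 0")
  case True
  have "Re a = lam" unfolding a_def by simp
  thus ?thesis using True lam by (intro exI[of _ a]) auto
next
  case False
  define b where "b = - k * complex_of_real T"
  define \<rho> where "\<rho> = exp (- lam * T)"
  have b: "b \<noteq> 0" unfolding b_def using False T by auto
  have \<rho>: "0 < \<rho>" "\<rho> < 1" "ln \<rho> = - lam * T" unfolding \<rho>_def using T lam by auto
  obtain s where s: "Re b + ln \<rho> < Re s" "s * exp s = complex_of_real \<rho> * b * exp b"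
    using lambert_root_Re_gt[OF b \<rho>(1,2)] by blast
  define z where "z = a + (s - b) / complex_of_real T"
  have "exp (- a * complex_of_real T) = \<rho>"
    unfolding a_def \<rho>_def exp_of_real[symmetric] using exp_minus_mult_2pi_shift[OF T] by simp
  moreover have "- z * complex_of_real T = - a * complex_of_real T + (b - s)"
    unfolding z_def using T by (simp add: field_simps)
  ultimately have "exp (- z * complex_of_real T) = \<rho> * exp b / exp s"
    by (metis exp_add exp_diff times_divide_eq_right)
  hence "b * exp (- z * complex_of_real T) = complex_of_real \<rho> * b * exp b / exp s" by simp
  also have "\<dots> = s" unfolding s(2)[symmetric] by simp
  finally have "b * exp (- z * complex_of_real T) = s" .
  moreover have "k = - b / complex_of_real T" unfolding b_def using T by simp
  ultimately have "(1 - exp (- z * complex_of_real T)) * k = (s - b) / complex_of_real T"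
    by (simp add: algebra_simps diff_divide_distrib)
  hence root: "z - a - (1 - exp (- z * complex_of_real T)) * k = 0" unfolding z_def by simp
  have "Re z = lam + (Re s - Re b) / T" unfolding z_def a_def by simp
  moreover have "(Re s - Re b) / T > - lam" using s(1) \<rho>(3) T by (simp add: field_simps)
  ultimately show ?thesis using root by (intro exI[of _ z]) simp
qed

definition mat_poly_apply :: "'a::field^'n^'n \<Rightarrow> 'a poly \<Rightarrow> 'a^'n \<Rightarrow> 'a^'n" where
  "mat_poly_apply L p v = (\<Sum>i\<le>degree p. coeff p i *s (((*v) L) ^^ i) v)"

lemma mat_poly_apply_upto:
  assumes "degree p \<le> N"
  shows "mat_poly_apply L p v = (\<Sum>i\<le>N. coeff p i *s (((*v) L) ^^ i) v)"
  unfolding mat_poly_apply_def using assms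
  by (intro sum.mono_neutral_left) (auto simp: coeff_eq_0)

lemma mat_poly_apply_add: "mat_poly_apply L (p + q) v = mat_poly_apply L p v + mat_poly_apply L q v"
proof -
  define N where "N = max (degree p) (degree q)"
  have "degree (p + q) \<le> N" unfolding N_def by (rule degree_add_le_max)
  hence "mat_poly_apply L (p + q) v = (\<Sum>i\<le>N. coeff (p + q) i *s (((*v) L) ^^ i) v)"
    by (rule mat_poly_apply_upto)
  also have "\<dots> = (\<Sum>i\<le>N. coeff p i *s (((*v) L) ^^ i) v)
                   + (\<Sum>i\<le>N. coeff q i *s (((*v) L) ^^ i) v)"
    by (simp add: vec.scale_left_distrib sum.distrib)
  also have "\<dots> = mat_poly_apply L p v + mat_poly_apply L q v"
    by (simp add: mat_poly_apply_upto[of p N] mat_poly_apply_upto[of q N] N_def)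
  finally show ?thesis .
qed

lemma mat_poly_apply_smult: "mat_poly_apply L (smult c p) v = c *s mat_poly_apply L p v"
proof -
  have "mat_poly_apply L (smult c p) v
          = (\<Sum>i\<le>degree p. coeff (smult c p) i *s (((*v) L) ^^ i) v)"
    by (rule mat_poly_apply_upto) (rule degree_smult_le)
  also have "\<dots> = c *s mat_poly_apply L p v"
    unfolding mat_poly_apply_def by (simp add: vec.scale_sum_right vec.scale_scale)
  finally show ?thesis .
qed

lemma mat_poly_apply_diff:
  "mat_poly_apply L (p - q) v = mat_poly_apply L p v - mat_poly_apply L q v"
proof -
  have "p - q = p + smult (-1) q" by simp
  hence "mat_poly_apply L (p - q) v = mat_poly_apply L p v + (-1) *s mat_poly_apply L q v"
    by (simp only: mat_poly_apply_add mat_poly_apply_smult)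
  thus ?thesis by simp
qed

lemma mat_poly_apply_pCons_0: "mat_poly_apply L (pCons 0 p) v = L *v mat_poly_apply L p v"
proof -
  have "degree (pCons 0 p) \<le> Suc (degree p)" by (simp add: degree_pCons_le)
  hence "mat_poly_apply L (pCons 0 p) v
          = (\<Sum>i\<le>Suc (degree p). coeff (pCons 0 p) i *s (((*v) L) ^^ i) v)"
    by (rule mat_poly_apply_upto)
  also have "\<dots> = (\<Sum>i\<le>degree p. coeff p i *s (((*v) L) ^^ Suc i) v)"
    by (subst sum.atMost_Suc_shift) simp
  also have "\<dots> = L *v mat_poly_apply L p v"
    unfolding mat_poly_apply_def by (simp add: vec.sum vector_scalar_commute)
  finally show ?thesis .
qed

lemma mat_poly_apply_const: "mat_poly_apply L [:c:] v = c *s v"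
  unfolding mat_poly_apply_def by simp

lemma mat_poly_apply_linear_factor:
  "mat_poly_apply L ([:-\<mu>, 1:] * q) v = L *v mat_poly_apply L q v - \<mu> *s mat_poly_apply L q v"
proof -
  have "[:-\<mu>, 1:] * q = smult (-\<mu>) q + pCons 0 q" by simp
  hence "mat_poly_apply L ([:-\<mu>, 1:] * q) v
           = (-\<mu>) *s mat_poly_apply L q v + L *v mat_poly_apply L q v"
    by (simp only: mat_poly_apply_add mat_poly_apply_smult mat_poly_apply_pCons_0)
  thus ?thesis by (simp add: vec.scale_minus_left)
qed

lemma mat_poly_apply_monom: "mat_poly_apply L (monom c j) v = c *s (((*v) L) ^^ j) v"
  by (cases "c = 0")
    (simp_all add: mat_poly_apply_def coeff_monom degree_monom_eq if_distrib[of "\<lambda>x. x *s _"]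
      cong: if_cong)

lemma mat_poly_apply_sum:
  "finite I \<Longrightarrow> mat_poly_apply L (\<Sum>i\<in>I. f i) v = (\<Sum>i\<in>I. mat_poly_apply L (f i) v)"
proof (induction I rule: finite_induct)
  case empty thus ?case by (simp add: mat_poly_apply_def)
next
  case (insert x F) thus ?case by (simp add: mat_poly_apply_add)
qed

lemma funpow_mult_eigenvector:
  fixes A L :: "'a::field^'n^'n"
  assumes "A ** L = L ** A" "A *v v = a *s v"
  shows "A *v ((((*v) L) ^^ i) v) = a *s (((*v) L) ^^ i) v"
proof (induction i)
  case 0 thus ?case using assms by simp
next
  case (Suc i)
  have "A *v (((*v) L ^^ Suc i) v) = (A ** L) *v (((*v) L ^^ i) v)"
    by (simp add: matrix_vector_mul_assoc)
  also have "\<dots> = L *v (A *v (((*v) L ^^ i) v))" by (simp add: assms(1) matrix_vector_mul_assoc)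
  also have "\<dots> = a *s (((*v) L ^^ Suc i) v)"
    using Suc vector_scalar_commute[of L a "((*v) L ^^ i) v"] by simp
  finally show ?case .
qed

lemma mat_poly_apply_eigenvector:
  fixes A L :: "'a::field^'n^'n"
  assumes "A ** L = L ** A" "A *v v = a *s v"
  shows "A *v mat_poly_apply L p v = a *s mat_poly_apply L p v"
  unfolding mat_poly_apply_def
  by (simp add: vec.sum vector_scalar_commute funpow_mult_eigenvector[OF assms]
      vec.scale_sum_right vec.scale_scale mult.commute)

lemma annihilating_poly_exists:
  fixes L :: "'a::field^'n^'n" and v :: "'a^'n"
  shows "\<exists>p. p \<noteq> 0 \<and> mat_poly_apply L p v = 0"
proof -
  define u where "u i = (((*v) L) ^^ i) v" for i
  define N where "N = CARD('n)"
  show ?thesis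
  proof (cases "inj_on u {..N}")
    case False
    then obtain i j where ij: "i \<le> N" "j \<le> N" "i \<noteq> j" "u i = u j"
      unfolding inj_on_def by auto
    define p where "p = monom (1::'a) i - monom 1 j"
    have "coeff p i = 1" unfolding p_def using ij by simp
    hence "p \<noteq> 0" by auto
    moreover have "mat_poly_apply L p v = 0"
      using ij unfolding p_def mat_poly_apply_diff mat_poly_apply_monom u_def by simp
    ultimately show ?thesis by blast
  next
    case True
    define S where "S = u ` {..N}"
    have cS: "card S = Suc N" unfolding S_def using True by (simp add: card_image)
    have "vec.dim S \<le> N" unfolding N_def by (rule dim_subset_UNIV_cart_gen)
    hence "vec.dependent S" using cS by (intro vec.dependent_biggerset_general) auto
    then obtain t c where t: "finite t" "t \<subseteq> S" "(\<Sum>x\<in>t. c x *s x) = 0" "\<exists>x\<in>t. c x \<noteq> 0"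
      unfolding vec.dependent_explicit by blast
    define d where "d i = (if u i \<in> t then c (u i) else 0)" for i
    define p where "p = (\<Sum>i\<le>N. monom (d i) i)"
    have cp: "coeff p i = (if i \<le> N then d i else 0)" for i
      unfolding p_def by (simp add: coeff_sum coeff_monom)
    obtain x where x: "x \<in> t" "c x \<noteq> 0" using t by blast
    then obtain i where i: "i \<le> N" "u i = x" using t unfolding S_def by auto
    have "coeff p i \<noteq> 0" using cp i x unfolding d_def by simp
    hence "p \<noteq> 0" by auto
    moreover have "mat_poly_apply L p v = 0"
    proof -
      have "mat_poly_apply L p v = (\<Sum>i\<le>N. d i *s u i)" unfolding p_def
        by (simp add: mat_poly_apply_sum mat_poly_apply_monom u_def)
      also have "\<dots> = (\<Sum>i\<in>{i\<in>{..N}. u i \<in> t}. c (u i) *s u i)"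
        unfolding d_def by (intro sum.mono_neutral_cong_right) auto
      also have "\<dots> = (\<Sum>x\<in>u ` {i\<in>{..N}. u i \<in> t}. c x *s x)"
        using True by (subst sum.reindex) (auto intro: inj_on_subset)
      also have "u ` {i\<in>{..N}. u i \<in> t} = t" using t(2) unfolding S_def by auto
      finally show ?thesis using t(3) by simp
    qed
    ultimately show ?thesis by blast
  qed
qed

lemma commuting_common_eigenvector:
  fixes A L :: "complex^'n^'n" and v :: "complex^'n"
  assumes comm: "A ** L = L ** A" and v: "v \<noteq> 0" "A *v v = a *s v"
  shows "\<exists>w \<mu>. w \<noteq> 0 \<and> A *v w = a *s w \<and> L *v w = \<mu> *s w"
proof -
  define P where "P p \<longleftrightarrow> p \<noteq> 0 \<and> mat_poly_apply L p v = 0" for p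
  obtain p0 where "P p0" using annihilating_poly_exists[of L v] unfolding P_def by blast
  then obtain p where p: "P p" and pmin: "\<And>q. P q \<Longrightarrow> degree p \<le> degree q"
    using ex_has_least_nat[of P p0 degree] by blast
  have dp: "degree p > 0"
  proof (rule ccontr)
    assume "\<not> degree p > 0"
    hence "p = [:coeff p 0:]" by (metis gr0I degree_0_id)
    moreover have "coeff p 0 \<noteq> 0" using p \<open>\<not> degree p > 0\<close> unfolding P_def
      by (metis \<open>p = [:coeff p 0:]\<close> pCons_0_0)
    ultimately have "mat_poly_apply L p v \<noteq> 0"
      using v by (metis mat_poly_apply_const vec.scale_eq_0_iff)
    thus False using p unfolding P_def by simp
  qed
  obtain \<mu> where "poly p \<mu> = 0" using alg_closed_imp_poly_has_root[OF dp] by blast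
  then obtain q where q: "p = [:-\<mu>, 1:] * q" using poly_eq_0_iff_dvd by blast
  have q0: "q \<noteq> 0" using p q unfolding P_def by auto
  have "degree p = degree [:-\<mu>, 1::complex:] + degree q" unfolding q
    using q0 by (intro degree_mult_eq) auto
  hence "degree p = Suc (degree q)" by simp
  hence "\<not> P q" using pmin by fastforce
  hence w0: "mat_poly_apply L q v \<noteq> 0" using q0 unfolding P_def by auto
  have "L *v mat_poly_apply L q v - \<mu> *s mat_poly_apply L q v = 0"
    using p q mat_poly_apply_linear_factor[of L \<mu> q v] unfolding P_def by simp
  hence "L *v mat_poly_apply L q v = \<mu> *s mat_poly_apply L q v" by simp
  moreover have "A *v mat_poly_apply L q v = a *s mat_poly_apply L q v"
    by (rule mat_poly_apply_eigenvector[OF comm v(2)])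
  ultimately show ?thesis using w0 by blast
qed

lemma cmat_mult: "cmat (A ** B) = cmat A ** cmat B"
  unfolding cmat_def by (simp add: vec_eq_iff matrix_matrix_mult_def)

lemma mat_matrix_vector_mult: "mat c *v x = c *s x"
proof -
  have "(\<Sum>j\<in>UNIV. (if i = j then c else 0) * x $ j) = c * x $ i" for i
    by (simp add: if_distrib[of "\<lambda>t. t * _"] cong: if_cong)
  thus ?thesis by (simp add: vec_eq_iff matrix_vector_mult_def mat_def)
qed

lemma det_eq_0_if_kernel:
  fixes M :: "'a::field^'n^'n"
  assumes "w \<noteq> 0" "M *v w = 0"
  shows "det M = 0"
proof (rule ccontr)
  assume "det M \<noteq> 0"
  hence "inj ((*v) M)"
    using det_nz_iff_inj_gen[OF matrix_vector_mul_linear_gen[of M]]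
    by (simp add: matrix_of_matrix_vector_mul)
  moreover have "M *v w = M *v 0" using assms by simp
  ultimately show False using assms(1) by (meson injD)
qed

theorem corollary5:
  fixes f :: "real^'n \<Rightarrow> real^'n"
    and f' :: "real^'n \<Rightarrow> ((real^'n) \<Rightarrow>\<^sub>L (real^'n))"
    and xs :: "real^'n"
    and T lam :: real
    and n :: int
    and K :: "real^'n^'n"
  assumes C1_deriv: "\<And>x. (f has_derivative blinfun_apply (f' x)) (at x)"
    and C1_cont: "continuous_on UNIV f'"
    and equil: "f xs = 0"
    and T_pos: "T > 0"
    and lam_pos: "lam > 0"
    and eig_plus: "complex_of_real lam + 2 * of_real pi * of_int n * \<i> / complex_of_real T
                     \<in> mat_spectrum (matrix (blinfun_apply (f' xs)))"
    and eig_minus: "complex_of_real lam - 2 * of_real pi * of_int n * \<i> / complex_of_real T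
                     \<in> mat_spectrum (matrix (blinfun_apply (f' xs)))"
    and comm: "matrix (blinfun_apply (f' xs)) ** K = K ** matrix (blinfun_apply (f' xs))"
  shows "\<exists>z::complex. Re z > 0 \<and> char_fun (matrix (blinfun_apply (f' xs))) K T z = 0"
proof -
  define A where "A = matrix (blinfun_apply (f' xs))"
  define a where "a = complex_of_real lam + 2 * of_real pi * of_int n * \<i> / complex_of_real T"
  obtain v where "v \<noteq> 0" "cmat A *v v = a *s v"
    using eig_plus unfolding mat_spectrum_def A_def a_def by blast
  moreover have "cmat A ** cmat K = cmat K ** cmat A"
    using comm unfolding A_def by (simp flip: cmat_mult)
  ultimately obtain w k where w: "w \<noteq> 0" "cmat A *v w = a *s w" "cmat K *v w = k *s w"
    using commuting_common_eigenvector by blast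
  obtain z where z: "Re z > 0" "z - a - (1 - exp (- z * complex_of_real T)) * k = 0"
    using scalar_char_root[OF T_pos lam_pos, of n k] unfolding a_def by blast
  define e where "e = 1 - exp (- z * complex_of_real T)"
  have "(mat z - cmat A - mat e ** cmat K) *v w = z *s w - a *s w - e *s (k *s w)"
    by (simp add: matrix_vector_mult_diff_rdistrib mat_matrix_vector_mult w
        flip: matrix_vector_mul_assoc)
  also have "\<dots> = (z - a - e * k) *s w" by (simp add: vec.scale_left_diff_distrib)
  also have "\<dots> = 0" using z(2) unfolding e_def by simp
  finally have "char_fun A K T z = 0"
    using det_eq_0_if_kernel[OF w(1)] unfolding char_fun_def e_def by blast
  thus ?thesis using z(1) unfolding A_def by blast
qed

end
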